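(* Let $f$ be a piecewise contracting interval map on a compact interval $X$, with $\Delta$, $D$, $\widetilde X$ and attractor $\Lambda$ as defined in the context. Suppose that $f$ satisfies the separation property and that $D\subset\widetilde X$. Then the Hausdorff dimension of $\Lambda$ is equal to zero, and the topological entropy $h_{top}\big(f|(\Lambda\cap\widetilde X)\big)$ is equal to zero.
   Context: Setting. $X\subset\mathbb R$ is a non-degenerate compact interval with the Euclidean metric. A map $f:X\to X$ is a piecewise contracting interval map (PCIM) if there exist $\lambda\in(0,1)$ and $N\ge 1$ non-empty pairwise disjoint subintervals $X_1,\dots,X_N$ of $X$, open in $X$, with $X=\bigcup_{i=1}^N\overline{X_i}$ and $|f(x)-f(y)|\le\lambda|x-y|$ for all $x,y\in X_i$ and all $i$. The $X_i$ are called contraction pieces and are ordered from left to right: writing $X=[c_0,c_N]$, one has $X_1=[c_0,c_1)$, $X_2=(c_1,c_2)$, ..., $X_N=(c_{N-1},c_N]$ (one may also allow $X_1$ and/or $X_N$ to be open intervals, in which case $c_0$ and/or $c_N$ belong to $\Delta$ below). Put $X^*:=\bigcup_{i=1}^N X_i$ and $\Delta:=X\setminus X^*$ (a finite set). The values of $f$ on $\Delta$ are arbitrary. Put $\widetilde X:=\bigcap_{j=0}^\infty f^{-j}(X^* )$, the set of points whose orbit never meets $\Delta$. $D$ is the set of all one-sided limits $\lim_{y\to c^-}f(y)$ and $\lim_{y\to c^+}f(y)$ of $f$ at points $c\in\Delta$ (those that make sense within $X$). Separation property. $f$ is piecewise monotonic if $f|X_i$ is strictly monotone for every $i$. $f$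 satisfies the separation property if it is piecewise monotonic and $\overline{f(X_i)}\cap\overline{f(X_j)}=\emptyset$ for all $i\ne j$. Attractor. $\Lambda:=\bigcap_{n\ge1}\Lambda_n$, where $\Lambda_1=\overline{f(X\setminus\Delta)}$ and $\Lambda_{n+1}=\overline{f(\Lambda_n\setminus\Delta)}$ for $n\ge1$. (When $f$ is piecewise monotonic and $D\subset\widetilde X$, $\Lambda\cap\widetilde X$ is non-empty and $f$-invariant.) Topological entropy. For $n\ge1$ and $\epsilon>0$, a set $E\subset\Lambda\cap\widetilde X$ is an $(n,\epsilon)$-spanning set for $\Lambda\cap\widetilde X$ if for every $x\in\Lambda\cap\widetilde X$ there is $y\in E$ with $|f^j(x)-f^j(y)|<\epsilon$ for all $j\in\{0,\dots,n-1\}$. Let $r_n(\epsilon,\Lambda\cap\widetilde X)$ be the smallest cardinality of an $(n,\epsilon)$-spanning set for $\Lambda\cap\widetilde X$ (this number is finite under the hypotheses of the theorem). Then $$h_{top}\big(f|(\Lambda\cap\widetilde X)\big)=\lim_{\epsilon\to0}\limsup_{n\to\infty}\frac{\log r_n(\epsilon,\Lambda\cap\widetilde X)}{n}.$$ Hausdorff dimension is the usual one on $\mathbb R$. *)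

theory Defs
  imports "HOL-Analysis.Analysis"
begin

section \<open>Piecewise contracting interval maps\<close>

text \<open>
  A map of the interval \<open>X\<close> is a total function \<open>f :: real \<Rightarrow> real\<close> that maps \<open>X\<close> into itself; its
  values outside \<open>X\<close> are irrelevant. The contraction pieces are \<open>P 1, \<dots>, P N\<close>, ordered from left
  to right. An end piece may contain the corresponding end point of \<open>X\<close> or not.
\<close>

definition pcim :: "real set \<Rightarrow> (real \<Rightarrow> real) \<Rightarrow> nat \<Rightarrow> (nat \<Rightarrow> real set) \<Rightarrow> bool" where
  "pcim X f N P \<longleftrightarrow>
     (\<exists>a b. a < b \<and> X = {a..b}) \<and> f ` X \<subseteq> X \<and> N \<ge> 1 \<and>
     (\<forall>i\<in>{1..N}. P i \<noteq> {} \<and> is_interval (P i) \<and> openin (top_of_set X) (P i)) \<and>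
     disjoint_family_on P {1..N} \<and>
     (\<forall>i\<in>{1..N}. \<forall>j\<in>{1..N}. i < j \<longrightarrow> (\<forall>x\<in>P i. \<forall>y\<in>P j. x < y)) \<and>
     X = (\<Union>i\<in>{1..N}. closure (P i)) \<and>
     (\<exists>r. 0 < r \<and> r < 1 \<and>
        (\<forall>i\<in>{1..N}. \<forall>x\<in>P i. \<forall>y\<in>P i. \<bar>f x - f y\<bar> \<le> r * \<bar>x - y\<bar>))"

definition pieces_union :: "nat \<Rightarrow> (nat \<Rightarrow> real set) \<Rightarrow> real set" where
  "pieces_union N P = (\<Union>i\<in>{1..N}. P i)"

definition exceptional_set :: "real set \<Rightarrow> nat \<Rightarrow> (nat \<Rightarrow> real set) \<Rightarrow> real set" where
  "exceptional_set X N P = X - pieces_union N P"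

definition regular_points :: "real set \<Rightarrow> (real \<Rightarrow> real) \<Rightarrow> nat \<Rightarrow> (nat \<Rightarrow> real set) \<Rightarrow> real set" where
  "regular_points X f N P = (\<Inter>j. {x \<in> X. (f ^^ j) x \<in> pieces_union N P})"

text \<open>
  The side condition \<open>islimpt\<close> excludes one-sided limits at an end point of \<open>X\<close> from outside \<open>X\<close>,
  for which the limit filter would be trivial and every \<open>l\<close> would be a limit.
\<close>

definition one_sided_limits :: "real set \<Rightarrow> (real \<Rightarrow> real) \<Rightarrow> nat \<Rightarrow> (nat \<Rightarrow> real set) \<Rightarrow> real set" where
  "one_sided_limits X f N P =
     {l. \<exists>c\<in>exceptional_set X N P.
        c islimpt (X \<inter> {..<c}) \<and> (f \<longlongrightarrow> l) (at c within (X \<inter> {..<c})) \<or>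
        c islimpt (X \<inter> {c<..}) \<and> (f \<longlongrightarrow> l) (at c within (X \<inter> {c<..}))}"

definition piecewise_monotonic :: "(real \<Rightarrow> real) \<Rightarrow> nat \<Rightarrow> (nat \<Rightarrow> real set) \<Rightarrow> bool" where
  "piecewise_monotonic f N P \<longleftrightarrow>
     (\<forall>i\<in>{1..N}. strict_mono_on (P i) f \<or> strict_antimono_on (P i) f)"

definition separation_property :: "(real \<Rightarrow> real) \<Rightarrow> nat \<Rightarrow> (nat \<Rightarrow> real set) \<Rightarrow> bool" where
  "separation_property f N P \<longleftrightarrow>
     piecewise_monotonic f N P \<and>
     (\<forall>i\<in>{1..N}. \<forall>j\<in>{1..N}. i \<noteq> j \<longrightarrow> closure (f ` P i) \<inter> closure (f ` P j) = {})"

text \<open>The recursion starts from \<open>\<Lambda>\<^sub>0 = X\<close>, so that \<open>\<Lambda>\<^sub>1\<close> is the closure of \<open>f ` (X - \<Delta>)\<close>.\<close>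

primrec attractor_level ::
    "real set \<Rightarrow> (real \<Rightarrow> real) \<Rightarrow> nat \<Rightarrow> (nat \<Rightarrow> real set) \<Rightarrow> nat \<Rightarrow> real set" where
  "attractor_level X f N P 0 = X"
| "attractor_level X f N P (Suc n) =
     closure (f ` (attractor_level X f N P n - exceptional_set X N P))"

definition attractor :: "real set \<Rightarrow> (real \<Rightarrow> real) \<Rightarrow> nat \<Rightarrow> (nat \<Rightarrow> real set) \<Rightarrow> real set" where
  "attractor X f N P = (\<Inter>n\<in>{1..}. attractor_level X f N P n)"


section \<open>Hausdorff dimension\<close>

text \<open>
  The \<open>s\<close>-th power of the diameter, with the conventions that the empty set has weight \<open>0\<close> and that
  every non-empty set has weight \<open>1\<close> for \<open>s = 0\<close> (whereas \<open>0 powr 0 = 0\<close> in HOL).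
\<close>

definition diameter_weight :: "real \<Rightarrow> 'a::metric_space set \<Rightarrow> ennreal" where
  "diameter_weight s U =
     (if U = {} then 0 else if s = 0 then 1 else ennreal (diameter U powr s))"

text \<open>Boundedness is required because \<^const>\<open>diameter\<close> has no meaningful value on unbounded sets.\<close>

definition hausdorff_premeasure :: "real \<Rightarrow> real \<Rightarrow> 'a::metric_space set \<Rightarrow> ennreal" where
  "hausdorff_premeasure s \<delta> A =
     (INF U \<in> {U :: nat \<Rightarrow> 'a set. (\<forall>i. bounded (U i) \<and> diameter (U i) \<le> \<delta>) \<and> A \<subseteq> (\<Union>i. U i)}.
        \<Sum>i. diameter_weight s (U i))"

definition hausdorff_outer_measure :: "real \<Rightarrow> 'a::metric_space set \<Rightarrow> ennreal" where
  "hausdorff_outer_measure s A = (SUP \<delta>\<in>{0<..}. hausdorff_premeasure s \<delta> A)"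

definition hausdorff_dimension :: "'a::metric_space set \<Rightarrow> ennreal" where
  "hausdorff_dimension A = (INF s \<in> {s. 0 \<le> s \<and> hausdorff_outer_measure s A = 0}. ennreal s)"


section \<open>Topological entropy\<close>

definition spanning_set ::
    "('a::metric_space \<Rightarrow> 'a) \<Rightarrow> 'a set \<Rightarrow> nat \<Rightarrow> real \<Rightarrow> 'a set \<Rightarrow> bool" where
  "spanning_set f S n \<epsilon> E \<longleftrightarrow>
     E \<subseteq> S \<and> (\<forall>x\<in>S. \<exists>y\<in>E. \<forall>j<n. dist ((f ^^ j) x) ((f ^^ j) y) < \<epsilon>)"

text \<open>The value is \<open>\<infinity>\<close> if there is no finite spanning set.\<close>

definition spanning_number :: "('a::metric_space \<Rightarrow> 'a) \<Rightarrow> 'a set \<Rightarrow> nat \<Rightarrow> real \<Rightarrow> enat" where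
  "spanning_number f S n \<epsilon> =
     (INF E \<in> {E. spanning_set f S n \<epsilon> E}. if finite E then enat (card E) else \<infinity>)"

definition log_enat :: "enat \<Rightarrow> ereal" where
  "log_enat k = (case k of enat m \<Rightarrow> if m = 0 then - \<infinity> else ereal (ln (real m)) | \<infinity> \<Rightarrow> \<infinity>)"

definition entropy_at_scale :: "('a::metric_space \<Rightarrow> 'a) \<Rightarrow> 'a set \<Rightarrow> real \<Rightarrow> ereal" where
  "entropy_at_scale f S \<epsilon> =
     limsup (\<lambda>n. log_enat (spanning_number f S n \<epsilon>) / ereal (real n))"

definition topological_entropy :: "('a::metric_space \<Rightarrow> 'a) \<Rightarrow> 'a set \<Rightarrow> ereal" where
  "topological_entropy f S = Lim (at_right 0) (entropy_at_scale f S)"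

text \<open>The limit defining the entropy always exists, by monotonicity in \<open>\<epsilon>\<close>.\<close>

lemma spanning_number_antimono:
  assumes "\<delta> \<le> \<epsilon>"
  shows "spanning_number f S n \<epsilon> \<le> spanning_number f S n \<delta>"
  unfolding spanning_number_def
proof (rule INF_superset_mono)
  show "{E. spanning_set f S n \<delta> E} \<subseteq> {E. spanning_set f S n \<epsilon> E}"
  proof (clarsimp simp only: spanning_set_def mem_Collect_eq)
    fix E x
    assume "\<forall>x\<in>S. \<exists>y\<in>E. \<forall>j<n. dist ((f ^^ j) x) ((f ^^ j) y) < \<delta>" "x \<in> S"
    then obtain y where "y \<in> E" "\<forall>j<n. dist ((f ^^ j) x) ((f ^^ j) y) < \<delta>"
      by blast
    then show "\<exists>y\<in>E. \<forall>j<n. dist ((f ^^ j) x) ((f ^^ j) y) < \<epsilon>"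
      using assms less_le_trans by blast
  qed
qed auto

lemma log_enat_mono: "k \<le> l \<Longrightarrow> log_enat k \<le> log_enat l"
  by (cases k; cases l) (auto simp: log_enat_def)

lemma entropy_at_scale_antimono:
  assumes "\<delta> \<le> \<epsilon>"
  shows "entropy_at_scale f S \<epsilon> \<le> entropy_at_scale f S \<delta>"
  unfolding entropy_at_scale_def
proof (intro Limsup_mono eventually_mono[OF eventually_gt_at_top[of 0]])
  fix n :: nat assume "0 < n"
  then show "log_enat (spanning_number f S n \<epsilon>) / ereal (real n)
      \<le> log_enat (spanning_number f S n \<delta>) / ereal (real n)"
    by (intro ereal_divide_right_mono log_enat_mono spanning_number_antimono assms) auto
qed

lemma topological_entropy_tendsto:
  "(entropy_at_scale f S \<longlongrightarrow> topological_entropy f S) (at_right 0)"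
proof -
  have "(entropy_at_scale f S \<longlongrightarrow> (SUP \<epsilon>\<in>{0<..}. entropy_at_scale f S \<epsilon>)) (at_right 0)"
  proof (rule increasing_tendsto)
    show "\<forall>\<^sub>F \<epsilon> in at_right 0. entropy_at_scale f S \<epsilon> \<le> (SUP \<epsilon>\<in>{0<..}. entropy_at_scale f S \<epsilon>)"
      by (rule eventually_mono[OF eventually_at_right_less]) (auto intro: SUP_upper)
  next
    fix x assume "x < (SUP \<epsilon>\<in>{0<..}. entropy_at_scale f S \<epsilon>)"
    then obtain e where e: "0 < e" "x < entropy_at_scale f S e"
      by (auto simp: less_SUP_iff)
    have "\<forall>\<^sub>F \<epsilon> in at_right 0. \<epsilon> \<in> {0<..<e}"
      using e(1) by (rule eventually_at_right_real)
    then show "\<forall>\<^sub>F \<epsilon> in at_right 0. x < entropy_at_scale f S \<epsilon>"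
    proof (rule eventually_mono)
      fix \<epsilon> assume "\<epsilon> \<in> {0<..<e}"
      then have "entropy_at_scale f S e \<le> entropy_at_scale f S \<epsilon>"
        by (intro entropy_at_scale_antimono) simp
      with e(2) show "x < entropy_at_scale f S \<epsilon>"
        by (rule less_le_trans)
    qed
  qed
  then show ?thesis
    unfolding topological_entropy_def by (simp add: tendsto_Lim)
qed

end

theory Submission
  imports Defs
begin

text \<open>
  Both numbers vanish because the contraction is exponential in the number of iterates, whereas the
  number of pieces into which the discontinuities cut the interval grows only linearly.

  The separation property makes \<open>f\<close> injective on the union of the contraction pieces. Hence each point
  of \<open>\<Delta>\<close> is reached for the first time at time \<open>k\<close> from at most one point, and at most \<open>n * card \<Delta>\<close>
  points of \<open>X\<close> reach \<open>\<Delta>\<close> before time \<open>n\<close> (\<open>cuts_card\<close>). Between two consecutive such points the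
  iterates up to the \<open>n\<close>-th are continuous, so that the image of the segment stays inside one
  contraction piece at every step and shrinks by the factor \<open>r\<close> (\<open>segment_contraction\<close>).

  The \<open>n\<close>-th level of the attractor lies in the closure of the image under \<open>f ^^ n\<close> of the points that
  avoid \<open>\<Delta>\<close> before that time. It is thus covered by \<open>n * card \<Delta> + 1\<close> sets of diameter at most
  \<open>r ^ n * (b - a)\<close>, and the sum of the \<open>s\<close>-th powers of these diameters tends to \<open>0\<close> for every \<open>s > 0\<close>.

  For the entropy, points of the same cell that are \<open>\<epsilon>\<close>-close at the start remain \<open>\<epsilon>\<close>-close, since
  distances within a cell never grow. A fixed grid of mesh \<open>\<epsilon>\<close> together with the cells gives spanning
  sets of size linear in \<open>n\<close> (\<open>spanning_number_linear\<close>), so the exponential growth rate is at most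
  \<open>0\<close>. It is not \<open>- \<infinity>\<close>, because the attractor contains a regular point
  (\<open>attractor_meets_regular_points\<close>); the hypothesis on the one-sided limits enters exactly there. If
  an orbit of a regular point accumulates at a point whose orbit hits some \<open>c \<in> \<Delta>\<close>, then it
  accumulates at \<open>c\<close> from one side, hence also at a one-sided limit of \<open>f\<close> at \<open>c\<close>, which is regular.
\<close>

section \<open>Spanning sets of linear size\<close>

text \<open>
  One representative of each fibre of \<open>g\<close> forms a spanning set. The representatives must lie in \<open>S\<close>
  itself, which is why they are chosen with \<^const>\<open>inv_into\<close> instead of being centres of a grid.
\<close>

lemma spanning_number_le_card:
  assumes "finite F" "g ` S \<subseteq> F"
    and close: "\<And>x y j. x \<in> S \<Longrightarrow> y \<in> S \<Longrightarrow> g x = g y \<Longrightarrow> j < n \<Longrightarrow> dist ((f ^^ j) x) ((f ^^ j) y) < \<epsilon>"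
  shows "spanning_number f S n \<epsilon> \<le> enat (card F)"
proof -
  define E where "E = inv_into S g ` (g ` S)"
  have fin: "finite (g ` S)" using assms finite_subset by blast
  have "spanning_set f S n \<epsilon> E"
    unfolding spanning_set_def
  proof (intro conjI ballI)
    show "E \<subseteq> S" unfolding E_def by (auto intro: inv_into_into)
    fix x assume x: "x \<in> S"
    let ?y = "inv_into S g (g x)"
    have "?y \<in> S" "g ?y = g x" using x by (auto intro: inv_into_into f_inv_into_f)
    moreover have "?y \<in> E" using x unfolding E_def by blast
    ultimately show "\<exists>y\<in>E. \<forall>j<n. dist ((f ^^ j) x) ((f ^^ j) y) < \<epsilon>"
      using close[OF x, of ?y] by (intro bexI[of _ ?y]) auto
  qed
  moreover have "finite E" using fin unfolding E_def by simp
  ultimately have "spanning_number f S n \<epsilon> \<le> enat (card E)"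
    unfolding spanning_number_def by (intro INF_lower2[of E]) auto
  also have "card E \<le> card F"
    unfolding E_def using card_image_le[OF fin] card_mono[OF assms(1,2)] by (rule order.trans)
  finally show ?thesis by simp
qed

lemma spanning_number_ge_1:
  assumes "S \<noteq> {}"
  shows "1 \<le> spanning_number f S n \<epsilon>"
  unfolding spanning_number_def
proof (rule INF_greatest)
  fix E assume "E \<in> {E. spanning_set f S n \<epsilon> E}"
  then have "E \<noteq> {}" using assms unfolding spanning_set_def by blast
  then show "1 \<le> (if finite E then enat (card E) else \<infinity>)"
    by (simp add: one_enat_def Suc_le_eq card_gt_0_iff)
qed

text \<open>
  Non-emptiness gives the lower bound: the empty set has spanning number \<open>0\<close>, whose logarithm
  \<open>- \<infinity>\<close> would make the entropy \<open>- \<infinity>\<close> too.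
\<close>

lemma entropy_at_scale_zero:
  assumes "S \<noteq> {}" and bound: "\<And>n. spanning_number f S n \<epsilon> \<le> enat (C * Suc n)"
  shows "entropy_at_scale f S \<epsilon> = 0"
proof -
  have C: "C > 0"
    using order.trans[OF spanning_number_ge_1[OF assms(1)] bound[of 0]] by (simp add: one_enat_def)
  let ?h = "\<lambda>n. log_enat (spanning_number f S n \<epsilon>) / ereal (real n)"
  have log_1: "log_enat 1 = 0" by (simp add: log_enat_def one_enat_def)
  have lower: "\<forall>\<^sub>F n in sequentially. 0 \<le> ?h n"
    using eventually_gt_at_top[of 0]
  proof eventually_elim
    case (elim n)
    have "0 \<le> log_enat (spanning_number f S n \<epsilon>)"
      using log_enat_mono[OF spanning_number_ge_1[OF assms(1)]] log_1 by simp
    then have "0 / ereal (real n) \<le> ?h n" using elim by (intro ereal_divide_right_mono) auto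
    then show ?case by simp
  qed
  have upper: "\<forall>\<^sub>F n in sequentially.
      ?h n \<le> ereal (ln (real C) / real n + ln (real (Suc n)) / real (Suc n) * (1 + 1 / real n))"
    using eventually_gt_at_top[of 0]
  proof eventually_elim
    case (elim n)
    have "log_enat (spanning_number f S n \<epsilon>) \<le> log_enat (enat (C * Suc n))"
      by (rule log_enat_mono[OF bound])
    also have "\<dots> = ereal (ln (real C) + ln (real (Suc n)))"
      using C by (simp add: log_enat_def ln_mult del: of_nat_Suc mult_Suc_right)
    finally have "?h n \<le> ereal (ln (real C) + ln (real (Suc n))) / ereal (real n)"
      using elim by (intro ereal_divide_right_mono) auto
    \<comment> \<open>In this form the limit of \<open>ln m / m\<close> applies with \<open>m = Suc n\<close>.\<close>
    also have "\<dots> = ereal (ln (real C) / real n + ln (real (Suc n)) / real (Suc n) * (1 + 1 / real n))"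
    proof -
      have "1 + 1 / real n = real (Suc n) / real n" using elim by (simp add: field_simps)
      then show ?thesis using elim by (simp add: add_divide_distrib del: of_nat_Suc)
    qed
    finally show ?case .
  qed
  have ln_lim: "(\<lambda>n. ln (real (Suc n)) / real (Suc n)) \<longlonglongrightarrow> 0"
    using lim_ln_over_n by (rule LIMSEQ_Suc)
  have "(\<lambda>n. ln (real C) / real n + ln (real (Suc n)) / real (Suc n) * (1 + 1 / real n)) \<longlonglongrightarrow> 0 + 0 * (1 + 0)"
    by (intro tendsto_add tendsto_mult ln_lim tendsto_const lim_const_over_n)
  then have "(\<lambda>n. ereal (ln (real C) / real n + ln (real (Suc n)) / real (Suc n) * (1 + 1 / real n))) \<longlonglongrightarrow> ereal 0"
    by (intro tendsto_ereal) simp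
  then have "?h \<longlonglongrightarrow> 0"
    using tendsto_sandwich[OF lower upper tendsto_const] by (simp add: zero_ereal_def)
  then show ?thesis
    unfolding entropy_at_scale_def by (intro lim_imp_Limsup) auto
qed

lemma topological_entropy_zero:
  assumes "\<And>\<epsilon>. \<epsilon> > 0 \<Longrightarrow> entropy_at_scale f S \<epsilon> = 0"
  shows "topological_entropy f S = 0"
proof -
  have "\<forall>\<^sub>F \<epsilon> in at_right 0. entropy_at_scale f S \<epsilon> = 0"
    by (rule eventually_mono[OF eventually_at_right_less]) (rule assms)
  then have "(entropy_at_scale f S \<longlongrightarrow> 0) (at_right 0)"
    by (rule tendsto_eventually)
  then show ?thesis
    using topological_entropy_tendsto tendsto_unique trivial_limit_at_right_real by blast
qed

section \<open>Points that avoid the exceptional set\<close>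

text \<open>
  The linear bound on the number of cells rests on the injectivity of \<open>f\<close> on the union of the pieces;
  the separation property provides it.
\<close>

locale injective_pcim =
  fixes a b r :: real and f :: "real \<Rightarrow> real" and N :: nat and P :: "nat \<Rightarrow> real set"
  assumes a_less_b: "a < b"
    and maps_to: "x \<in> {a..b} \<Longrightarrow> f x \<in> {a..b}"
    and r_pos: "0 < r" and r_less_1: "r < 1"
    and piece_interval: "i \<in> {1..N} \<Longrightarrow> is_interval (P i)"
    and piece_open: "i \<in> {1..N} \<Longrightarrow> openin (top_of_set {a..b}) (P i)"
    and pieces_disjoint: "disjoint_family_on P {1..N}"
    and closures_cover: "{a..b} = (\<Union>i\<in>{1..N}. closure (P i))"
    and contraction: "i \<in> {1..N} \<Longrightarrow> x \<in> P i \<Longrightarrow> y \<in> P i \<Longrightarrow> \<bar>f x - f y\<bar> \<le> r * \<bar>x - y\<bar>"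
    and inj_pieces: "inj_on f (pieces_union N P)"
begin

abbreviation "pieces \<equiv> pieces_union N P"
abbreviation "\<Delta> \<equiv> exceptional_set {a..b} N P"

lemma pieces_subset: "pieces \<subseteq> {a..b}"
  unfolding pieces_union_def using closures_cover closure_subset by blast

lemma funpow_maps_to: "x \<in> {a..b} \<Longrightarrow> (f ^^ n) x \<in> {a..b}"
  by (induction n) (use maps_to in auto)

text \<open>
  A point of the closure of an interval that is missing from it can only be one of its end points.
\<close>

lemma finite_exceptional: "finite \<Delta>"
proof (rule finite_subset)
  show "\<Delta> \<subseteq> (\<Union>i\<in>{1..N}. {Inf (P i), Sup (P i)})"
  proof
    fix x assume x: "x \<in> \<Delta>"
    then obtain i where i: "i \<in> {1..N}" "x \<in> closure (P i)" "x \<notin> P i"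
      unfolding exceptional_set_def pieces_union_def using closures_cover by blast
    have sub: "P i \<subseteq> {a..b}"
      using i pieces_subset unfolding pieces_union_def by blast
    then have bdd: "bdd_above (P i)" "bdd_below (P i)"
      by (auto intro: bdd_above_mono bdd_below_mono)
    have "P i \<noteq> {}" using i by auto
    have "P i \<subseteq> {Inf (P i)..Sup (P i)}"
      using bdd by (auto intro: cInf_lower cSup_upper)
    then have "x \<in> {Inf (P i)..Sup (P i)}"
      using i(2) closure_minimal closed_atLeastAtMost by blast
    moreover have "\<not> (Inf (P i) < x \<and> x < Sup (P i))"
    proof
      assume "Inf (P i) < x \<and> x < Sup (P i)"
      then obtain u v where "u \<in> P i" "u < x" "v \<in> P i" "x < v"
        using bdd \<open>P i \<noteq> {}\<close> cInf_less_iff less_cSup_iff by metis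
      then have "x \<in> P i"
        using piece_interval[OF i(1)] unfolding is_interval_1 by (meson less_imp_le)
      then show False using i by simp
    qed
    ultimately show "x \<in> (\<Union>i\<in>{1..N}. {Inf (P i), Sup (P i)})"
      using i(1) by force
  qed
qed auto

text \<open>
  The pieces are disjoint and relatively open, so they separate any connected set that meets two
  of them.
\<close>

lemma connected_subset_piece:
  assumes "connected C" "C \<subseteq> pieces" "C \<noteq> {}"
  obtains i where "i \<in> {1..N}" "C \<subseteq> P i"
proof -
  obtain x i where x: "x \<in> C" "i \<in> {1..N}" "x \<in> P i"
    using assms unfolding pieces_union_def by blast
  define Q where "Q = (\<Union>j\<in>{1..N} - {i}. P j)"
  have Q: "openin (top_of_set {a..b}) Q"
    unfolding Q_def using piece_open by (intro openin_Union) auto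
  have CX: "C \<subseteq> {a..b}" using assms pieces_subset by blast
  have restrict: "openin (top_of_set C) (C \<inter> V)" if "openin (top_of_set {a..b}) V" for V
    using that CX unfolding openin_open by blast
  have "openin (top_of_set C) (C \<inter> P i)" "openin (top_of_set C) (C \<inter> Q)"
    using restrict[OF piece_open[OF x(2)]] restrict[OF Q] by auto
  moreover have "C \<subseteq> (C \<inter> P i) \<union> (C \<inter> Q)"
    using assms(2) unfolding Q_def pieces_union_def by blast
  moreover have "(C \<inter> P i) \<inter> (C \<inter> Q) = {}"
    using pieces_disjoint x(2) unfolding Q_def disjoint_family_on_def by blast
  ultimately have "C \<inter> Q = {}"
    using assms(1) x unfolding connected_openin by blast
  then have "C \<subseteq> P i" using \<open>C \<subseteq> (C \<inter> P i) \<union> (C \<inter> Q)\<close> by blast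
  with x that show ?thesis by blast
qed

lemma continuous_within_pieces:
  assumes "x \<in> pieces"
  shows "(f \<longlongrightarrow> f x) (at x within {a..b})"
proof -
  obtain i where i: "i \<in> {1..N}" "x \<in> P i"
    using assms unfolding pieces_union_def by blast
  obtain T where T: "open T" "P i = {a..b} \<inter> T"
    using piece_open[OF i(1)] unfolding openin_open by blast
  have "\<forall>\<^sub>F y in at x within {a..b}. y \<in> T"
    using T i(2) by (intro topological_tendstoD[OF tendsto_ident_at]) auto
  moreover have "\<forall>\<^sub>F y in at x within {a..b}. y \<in> {a..b}"
    by (auto simp: eventually_at_filter)
  ultimately have "\<forall>\<^sub>F y in at x within {a..b}. norm (f y - f x) \<le> r * norm (y - x)"
    by eventually_elim (use T(2) contraction[OF i(1)] i(2) in auto)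
  moreover have "((\<lambda>y. r * norm (y - x)) \<longlongrightarrow> 0) (at x within {a..b})"
    by (auto intro!: tendsto_eq_intros)
  ultimately have "((\<lambda>y. f y - f x) \<longlongrightarrow> 0) (at x within {a..b})"
    by (rule Lim_null_comparison)
  then show ?thesis by (simp add: LIM_zero_iff)
qed

definition survivors :: "nat \<Rightarrow> real set" where
  "survivors n = {x \<in> {a..b}. \<forall>j<n. (f ^^ j) x \<in> pieces}"

definition first_hits :: "nat \<Rightarrow> real set" where
  "first_hits k = {x \<in> survivors k. (f ^^ k) x \<in> \<Delta>}"

definition cuts :: "nat \<Rightarrow> real set" where
  "cuts n = (\<Union>k<n. first_hits k)"

text \<open>
  The cuts divide the rest of the interval into cells. A cell is recorded by the number of cuts to
  the left of its points, which avoids any enumeration of the cuts.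
\<close>

definition cell_index :: "nat \<Rightarrow> real \<Rightarrow> nat" where
  "cell_index n x = card (cuts n \<inter> {..x})"

lemma survivors_antimono: "m \<le> n \<Longrightarrow> survivors n \<subseteq> survivors m"
  by (auto simp: survivors_def)

text \<open>
  Iterates are injective only along orbits that stay in the pieces, as the values of \<open>f\<close> on \<open>\<Delta>\<close> are
  arbitrary. This is why the hits of \<open>\<Delta>\<close> are sorted by the time of the first hit.
\<close>

lemma inj_on_survivors: "inj_on (f ^^ n) (survivors n)"
proof (induction n)
  case (Suc n)
  show ?case
  proof (rule inj_onI)
    fix x y assume xy: "x \<in> survivors (Suc n)" "y \<in> survivors (Suc n)"
      and eq: "(f ^^ Suc n) x = (f ^^ Suc n) y"
    then have "(f ^^ n) x = (f ^^ n) y"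
      using inj_pieces unfolding survivors_def inj_on_def by simp
    moreover have "x \<in> survivors n" "y \<in> survivors n"
      using xy unfolding survivors_def by auto
    ultimately show "x = y" using Suc.IH by (meson inj_onD)
  qed
qed simp

lemma first_hits_finite: "finite (first_hits k)"
  and first_hits_card: "card (first_hits k) \<le> card \<Delta>"
proof -
  have inj: "inj_on (f ^^ k) (first_hits k)"
    using inj_on_survivors by (rule inj_on_subset) (auto simp: first_hits_def)
  have sub: "(f ^^ k) ` first_hits k \<subseteq> \<Delta>"
    by (auto simp: first_hits_def)
  show "finite (first_hits k)" using inj sub finite_exceptional by (meson inj_on_finite)
  show "card (first_hits k) \<le> card \<Delta>"
    using inj sub finite_exceptional by (meson card_inj_on_le)
qed

lemma cuts_finite: "finite (cuts n)"
  unfolding cuts_def using first_hits_finite by blast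

lemma cuts_card: "card (cuts n) \<le> n * card \<Delta>"
proof -
  have "card (cuts n) \<le> (\<Sum>k<n. card (first_hits k))"
    unfolding cuts_def by (rule card_UN_le) simp
  also have "\<dots> \<le> (\<Sum>k<n. card \<Delta>)"
    by (intro sum_mono first_hits_card)
  finally show ?thesis by simp
qed

lemma survivors_eq: "survivors n = {a..b} - cuts n"
proof (induction n)
  case (Suc n)
  have "survivors (Suc n) = survivors n - first_hits n"
    using funpow_maps_to
    by (auto simp: survivors_def first_hits_def exceptional_set_def less_Suc_eq)
  then show ?case using Suc.IH by (auto simp: cuts_def less_Suc_eq)
qed (auto simp: survivors_def cuts_def)

section \<open>Contraction between consecutive cuts\<close>

text \<open>
  Contraction and continuity have to be proved together: the image of the segment must be connected
  to lie in a single piece, where the next contraction step applies.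
\<close>

lemma segment_contraction:
  assumes "x \<le> y" "{x..y} \<subseteq> survivors n"
  shows "continuous_on {x..y} (f ^^ n) \<and> \<bar>(f ^^ n) x - (f ^^ n) y\<bar> \<le> r ^ n * \<bar>x - y\<bar>"
  using assms(2)
proof (induction n)
  case (Suc n)
  have IH: "continuous_on {x..y} (f ^^ n)" "\<bar>(f ^^ n) x - (f ^^ n) y\<bar> \<le> r ^ n * \<bar>x - y\<bar>"
    using Suc.IH survivors_antimono[of n "Suc n"] Suc.prems by auto
  let ?C = "(f ^^ n) ` {x..y}"
  have C: "?C \<subseteq> pieces" using Suc.prems unfolding survivors_def by auto
  have "connected ?C" using IH(1) by (intro connected_continuous_image) auto
  then obtain i where i: "i \<in> {1..N}" "?C \<subseteq> P i"
    using connected_subset_piece[OF _ C] assms(1) by auto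
  have "continuous_on ?C f"
    unfolding continuous_on_def
  proof
    fix z assume "z \<in> ?C"
    with C have "z \<in> pieces" by (rule subsetD)
    then show "(f \<longlongrightarrow> f z) (at z within ?C)"
      using C pieces_subset by (intro tendsto_within_subset[OF continuous_within_pieces]) auto
  qed
  then have "continuous_on {x..y} (f ^^ Suc n)"
    unfolding funpow.simps using IH(1) by (intro continuous_on_compose)
  moreover have "\<bar>(f ^^ Suc n) x - (f ^^ Suc n) y\<bar> \<le> r * \<bar>(f ^^ n) x - (f ^^ n) y\<bar>"
    using contraction[OF i(1)] i(2) assms(1) by (simp add: image_subset_iff)
  moreover have "r * \<bar>(f ^^ n) x - (f ^^ n) y\<bar> \<le> r * (r ^ n * \<bar>x - y\<bar>)"
    using IH(2) r_pos by (intro mult_left_mono) auto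
  ultimately show ?case by (simp add: mult.assoc)
qed simp

text \<open>
  Two points with equally many cuts to their left have no cut between them.
\<close>

lemma cell_contraction:
  assumes "x \<in> survivors n" "y \<in> survivors n" "cell_index n x = cell_index n y" "j \<le> n"
  shows "\<bar>(f ^^ j) x - (f ^^ j) y\<bar> \<le> r ^ j * \<bar>x - y\<bar>"
  using assms(1-3)
proof (induction x y rule: linorder_wlog)
  case (le x y)
  have "cuts n \<inter> {..x} = cuts n \<inter> {..y}"
    using le cuts_finite unfolding cell_index_def
    by (intro card_subset_eq) auto
  then have same: "z \<le> x \<longleftrightarrow> z \<le> y" if "z \<in> cuts n" for z
    using that by blast
  have "{x..y} \<subseteq> survivors n"
  proof
    fix z assume z: "z \<in> {x..y}"
    then have "z \<in> cuts n \<Longrightarrow> z = x" using same by fastforce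
    then show "z \<in> survivors n" using le z unfolding survivors_eq by auto
  qed
  then have "{x..y} \<subseteq> survivors j"
    using survivors_antimono[OF assms(4)] by blast
  then show ?case using segment_contraction le by blast
next
  case (sym x y)
  then show ?case by (simp add: abs_minus_commute)
qed

lemma cell_index_le: "cell_index n x \<le> n * card \<Delta>"
  unfolding cell_index_def
  using cuts_card card_mono[OF cuts_finite, of "cuts n \<inter> {..x}" n] by (meson Int_lower1 le_trans)

section \<open>Hausdorff dimension of the attractor\<close>

text \<open>
  Continuity on the relatively open pieces lets closures be postponed: the closures taken at each
  level of the attractor can be replaced by a single one at the end.
\<close>

lemma image_closure_subset:
  assumes "A \<subseteq> {a..b}"
  shows "f ` (closure A - \<Delta>) \<subseteq> closure (f ` (A - \<Delta>))"
proof
  fix z assume "z \<in> f ` (closure A - \<Delta>)"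
  then obtain x where x: "x \<in> closure A" "x \<notin> \<Delta>" "z = f x" by blast
  have "x \<in> {a..b}" using x(1) assms closure_minimal closed_atLeastAtMost by blast
  then have xp: "x \<in> pieces" using x(2) by (simp add: exceptional_set_def)
  then obtain i where i: "i \<in> {1..N}" "x \<in> P i" unfolding pieces_union_def by blast
  obtain T where T: "open T" "P i = {a..b} \<inter> T"
    using piece_open[OF i(1)] unfolding openin_open by blast
  have "x \<in> closure (A \<inter> T)"
    using x(1) i(2) T open_Int_closure_subset[of T A] by (auto simp: Int_commute)
  moreover have "A \<inter> T \<subseteq> A - \<Delta>"
    using assms T(2) i(1) unfolding exceptional_set_def pieces_union_def by blast
  ultimately obtain s where s: "\<And>n. s n \<in> A - \<Delta>" "s \<longlonglongrightarrow> x"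
    unfolding closure_sequential by blast
  have "(\<lambda>n. f (s n)) \<longlonglongrightarrow> f x"
  proof (rule continuous_within_tendsto_compose'[of x "{a..b}" f s])
    show "continuous (at x within {a..b}) f"
      using continuous_within_pieces[OF xp] by (simp add: continuous_within)
    show "s n \<in> {a..b}" for n using s(1) assms by blast
  qed (fact s(2))
  then show "z \<in> closure (f ` (A - \<Delta>))"
    unfolding closure_sequential x(3) using s(1) by (intro exI[of _ "\<lambda>n. f (s n)"]) simp
qed

lemma attractor_level_subset_closure:
  "attractor_level {a..b} f N P n \<subseteq> closure ((f ^^ n) ` survivors n)"
proof (induction n)
  case (Suc n)
  let ?A = "(f ^^ n) ` survivors n"
  have A: "?A \<subseteq> {a..b}" using funpow_maps_to by (auto simp: survivors_def)
  have "f ` (attractor_level {a..b} f N P n - \<Delta>) \<subseteq> f ` (closure ?A - \<Delta>)"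
    using Suc.IH by blast
  also have "\<dots> \<subseteq> closure (f ` (?A - \<Delta>))"
    by (rule image_closure_subset[OF A])
  also have "\<dots> \<subseteq> closure ((f ^^ Suc n) ` survivors (Suc n))"
    using A by (intro closure_mono) (auto simp: survivors_def exceptional_set_def less_Suc_eq)
  finally show ?case
    by (simp add: closure_minimal)
next
  case 0
  have "survivors 0 = {a..b}" by (auto simp: survivors_def)
  then show ?case by simp
qed

text \<open>
  The sets are the closures of the images of the cells.
\<close>

lemma attractor_level_cover:
  obtains U :: "nat \<Rightarrow> real set"
  where "attractor_level {a..b} f N P n \<subseteq> (\<Union>i. U i)"
    and "\<And>i. bounded (U i)" and "\<And>i. diameter (U i) \<le> r ^ n * (b - a)"
    and "\<And>i. i > n * card \<Delta> \<Longrightarrow> U i = {}"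
proof
  define V where "V i = (f ^^ n) ` {x \<in> survivors n. cell_index n x = i}" for i
  have V: "V i \<subseteq> {a..b}" for i
    using funpow_maps_to by (auto simp: V_def survivors_def)
  show bdd: "bounded (closure (V i))" for i
    using bounded_subset[OF bounded_closed_interval V] by (rule bounded_closure)
  show "diameter (closure (V i)) \<le> r ^ n * (b - a)" for i
  proof -
    have "diameter (V i) \<le> r ^ n * (b - a)"
    proof (rule diameter_le)
      show "V i \<noteq> {} \<or> 0 \<le> r ^ n * (b - a)" using r_pos a_less_b by simp
      fix u v assume "u \<in> V i" "v \<in> V i"
      then obtain x y where xy: "x \<in> survivors n" "y \<in> survivors n" "cell_index n x = cell_index n y"
        "u = (f ^^ n) x" "v = (f ^^ n) y"
        unfolding V_def by auto
      then have "\<bar>u - v\<bar> \<le> r ^ n * \<bar>x - y\<bar>" using cell_contraction by blast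
      also have "\<dots> \<le> r ^ n * (b - a)"
        using xy r_pos by (intro mult_left_mono) (auto simp: survivors_def)
      finally show "norm (u - v) \<le> r ^ n * (b - a)" by simp
    qed
    moreover have "bounded (V i)" using bounded_subset[OF bounded_closed_interval V] .
    ultimately show ?thesis by (simp add: diameter_closure)
  qed
  show "closure (V i) = {}" if "i > n * card \<Delta>" for i
    using that cell_index_le[of n] unfolding V_def by (auto dest: leD)
  have "(f ^^ n) ` survivors n \<subseteq> (\<Union>i\<le>n * card \<Delta>. closure (V i))"
  proof
    fix y assume "y \<in> (f ^^ n) ` survivors n"
    then obtain x where x: "x \<in> survivors n" "y = (f ^^ n) x" by blast
    then have "y \<in> V (cell_index n x)" unfolding V_def by simp
    then have "y \<in> closure (V (cell_index n x))" using closure_subset by (rule subsetD[rotated])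
    then show "y \<in> (\<Union>i\<le>n * card \<Delta>. closure (V i))" using cell_index_le[of n x] by blast
  qed
  then have "closure ((f ^^ n) ` survivors n) \<subseteq> (\<Union>i\<le>n * card \<Delta>. closure (V i))"
    by (intro closure_minimal closed_UN) auto
  then show "attractor_level {a..b} f N P n \<subseteq> (\<Union>i. closure (V i))"
    using attractor_level_subset_closure by blast
qed

text \<open>
  The covers of the levels have linearly many members of exponentially small diameter.
\<close>

lemma hausdorff_outer_measure_attractor:
  assumes "s > 0"
  shows "hausdorff_outer_measure s (attractor {a..b} f N P) = 0"
proof -
  let ?d = "real (card \<Delta>)"
  define q where "q = r powr s"
  have q: "0 < q" "q < 1" unfolding q_def using r_pos r_less_1 assms
    using powr_less_mono2[of s r 1] by auto
  \<comment> \<open>The total weight of the cover of level \<open>n\<close>.\<close>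
  define B where "B n = (real n * ?d + 1) * (r ^ n * (b - a)) powr s" for n
  have B_eq: "B n = (b - a) powr s * (?d * (real n * q ^ n) + q ^ n)" for n
  proof -
    have "(r ^ n) powr s = (r powr real n) powr s" using r_pos by (simp add: powr_realpow)
    also have "\<dots> = (r powr s) powr real n" by (simp add: powr_powr mult.commute)
    also have "\<dots> = q ^ n" unfolding q_def using r_pos by (intro powr_realpow) simp
    finally have "(r ^ n) powr s = q ^ n" .
    then have "(r ^ n * (b - a)) powr s = q ^ n * (b - a) powr s"
      using r_pos a_less_b by (simp add: powr_mult)
    then show ?thesis by (simp add: B_def algebra_simps)
  qed
  have "(\<lambda>n. real n * q ^ n) \<longlonglongrightarrow> 0" "(\<lambda>n. q ^ n) \<longlonglongrightarrow> 0"
    using q powser_times_n_limit_0[of q] by (auto intro: LIMSEQ_realpow_zero)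
  then have "(\<lambda>n. (b - a) powr s * (?d * (real n * q ^ n) + q ^ n)) \<longlonglongrightarrow> (b - a) powr s * (?d * 0 + 0)"
    by (intro tendsto_mult tendsto_add tendsto_const)
  then have B_lim: "B \<longlonglongrightarrow> 0"
    unfolding B_eq[abs_def] by simp
  have "hausdorff_premeasure s \<delta> (attractor {a..b} f N P) = 0" if "\<delta> > 0" for \<delta>
  proof -
    have "(\<lambda>n. r ^ n * (b - a)) \<longlonglongrightarrow> 0"
      using tendsto_mult_right[OF LIMSEQ_realpow_zero[of r], of "b - a"] r_pos r_less_1 by simp
    then have small: "\<forall>\<^sub>F n in sequentially. r ^ n * (b - a) < \<delta>"
      using that order_tendstoD(2) by blast
    have bound: "\<forall>\<^sub>F n in sequentially.
        hausdorff_premeasure s \<delta> (attractor {a..b} f N P) \<le> ennreal (B n)"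
      using small eventually_gt_at_top[of 0]
    proof eventually_elim
      case (elim n)
      obtain U where U: "attractor_level {a..b} f N P n \<subseteq> (\<Union>i. U i)"
        "\<And>i. bounded (U i)" "\<And>i. diameter (U i) \<le> r ^ n * (b - a)"
        "\<And>i. i > n * card \<Delta> \<Longrightarrow> U i = {}"
        using attractor_level_cover by blast
      have "attractor {a..b} f N P \<subseteq> (\<Union>i. U i)"
        using U(1) elim unfolding attractor_def by fastforce
      then have "hausdorff_premeasure s \<delta> (attractor {a..b} f N P) \<le> (\<Sum>i. diameter_weight s (U i))"
        unfolding hausdorff_premeasure_def
        using U(2) order.trans[OF U(3) less_imp_le[OF elim(1)]] by (intro INF_lower) auto
      also have "\<dots> = (\<Sum>i\<le>n * card \<Delta>. diameter_weight s (U i))"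
        using U(4) by (intro suminf_finite) (auto simp: diameter_weight_def)
      also have "\<dots> \<le> (\<Sum>i\<le>n * card \<Delta>. ennreal ((r ^ n * (b - a)) powr s))"
      proof (rule sum_mono)
        fix i
        have "diameter (U i) powr s \<le> (r ^ n * (b - a)) powr s"
          using U assms by (intro powr_mono2) (auto intro: diameter_ge_0)
        then show "diameter_weight s (U i) \<le> ennreal ((r ^ n * (b - a)) powr s)"
          using assms by (simp add: diameter_weight_def ennreal_leI)
      qed
      also have "\<dots> = ennreal (B n)"
        by (simp add: B_def ennreal_mult ennreal_of_nat_eq_real_of_nat add.commute flip: ennreal_1 ennreal_plus)
      finally show ?case .
    qed
    have "(\<lambda>n. ennreal (B n)) \<longlonglongrightarrow> ennreal 0"
      using B_lim by (intro tendsto_ennrealI)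
    then have "hausdorff_premeasure s \<delta> (attractor {a..b} f N P) \<le> ennreal 0"
      using bound by (rule tendsto_lowerbound) simp
    then show ?thesis by simp
  qed
  then show ?thesis
    unfolding hausdorff_outer_measure_def by (auto simp: bot_ennreal[symmetric] intro!: SUP_eqI)
qed

lemma hausdorff_dimension_attractor: "hausdorff_dimension (attractor {a..b} f N P) = 0"
proof -
  have "hausdorff_dimension (attractor {a..b} f N P) \<le> ennreal s" if "s > 0" for s
    unfolding hausdorff_dimension_def
    using hausdorff_outer_measure_attractor[OF that] that by (intro INF_lower) auto
  then have "hausdorff_dimension (attractor {a..b} f N P) \<le> 0 + ennreal s" if "s > 0" for s
    using that by simp
  then have "hausdorff_dimension (attractor {a..b} f N P) \<le> 0"
    by (rule ennreal_le_epsilon)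
  then show ?thesis by simp
qed

section \<open>Entropy on the regular points\<close>

lemma regular_points_eq: "regular_points {a..b} f N P = (\<Inter>n. survivors n)"
  unfolding regular_points_def survivors_def by auto

text \<open>
  A point is classified by its cell and by its position in a grid of mesh \<open>\<epsilon>\<close>. The grid takes care of
  the first iterates, for which the contraction alone would not yet reach the scale \<open>\<epsilon>\<close>; it does not
  depend on \<open>n\<close>.
\<close>

lemma spanning_number_linear:
  assumes "S \<subseteq> regular_points {a..b} f N P" "\<epsilon> > 0"
  obtains C where "\<And>n. spanning_number f S n \<epsilon> \<le> enat (C * Suc n)"
proof
  define K where "K = {0..\<lfloor>(b - a) / \<epsilon>\<rfloor>}"
  fix n
  define g where "g x = (cell_index n x, \<lfloor>(x - a) / \<epsilon>\<rfloor>)" for x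
  have S: "x \<in> survivors n" "x \<in> {a..b}" if "x \<in> S" for x
    using assms(1) that unfolding regular_points_eq by (auto simp: survivors_def)
  have "spanning_number f S n \<epsilon> \<le> enat (card ({..n * card \<Delta>} \<times> K))"
  proof (rule spanning_number_le_card)
    show "finite ({..n * card \<Delta>} \<times> K)" unfolding K_def by simp
    show "g ` S \<subseteq> {..n * card \<Delta>} \<times> K"
    proof
      fix p assume "p \<in> g ` S"
      then obtain x where x: "x \<in> S" "p = g x" by blast
      have "0 \<le> (x - a) / \<epsilon>" "(x - a) / \<epsilon> \<le> (b - a) / \<epsilon>"
        using S(2)[OF x(1)] assms(2) by (auto intro!: divide_right_mono)
      then have "\<lfloor>(x - a) / \<epsilon>\<rfloor> \<in> K" unfolding K_def by (simp add: floor_mono)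
      then show "p \<in> {..n * card \<Delta>} \<times> K" unfolding x(2) g_def using cell_index_le by simp
    qed
    fix x y j assume xy: "x \<in> S" "y \<in> S" "g x = g y" "j < n"
    have "\<bar>(x - a) / \<epsilon> - (y - a) / \<epsilon>\<bar> < 1"
      using xy(3) unfolding g_def by (simp, linarith)
    then have "\<bar>x - y\<bar> < \<epsilon>"
      using assms(2) by (simp add: diff_divide_distrib[symmetric] abs_divide)
    moreover have "\<bar>(f ^^ j) x - (f ^^ j) y\<bar> \<le> r ^ j * \<bar>x - y\<bar>"
      using cell_contraction[of x n y j] S xy unfolding g_def by auto
    moreover have "r ^ j * \<bar>x - y\<bar> \<le> 1 * \<bar>x - y\<bar>"
      using r_pos r_less_1 by (intro mult_right_mono power_le_one) auto
    ultimately show "dist ((f ^^ j) x) ((f ^^ j) y) < \<epsilon>"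
      by (simp add: dist_real_def)
  qed
  also have "card ({..n * card \<Delta>} \<times> K) \<le> (card K * Suc (card \<Delta>)) * Suc n"
    by (simp add: card_cartesian_product algebra_simps)
  finally show "spanning_number f S n \<epsilon> \<le> enat ((card K * Suc (card \<Delta>)) * Suc n)"
    by (simp only: enat_ord_simps)
qed

section \<open>Regular points in the attractor\<close>

text \<open>
  Finitely many points reach \<open>\<Delta>\<close> before any given time, hence countably many at all, whereas the
  interval is uncountable.
\<close>

lemma regular_points_nonempty: "regular_points {a..b} f N P \<noteq> {}"
proof
  assume "regular_points {a..b} f N P = {}"
  then have "{a..b} \<subseteq> (\<Union>n. cuts n)"
    unfolding regular_points_eq survivors_eq by blast
  moreover have "countable (\<Union>n. cuts n)"
    using cuts_finite by (intro countable_UN) (auto intro: countable_finite)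
  ultimately have "countable {a..b}" by (rule countable_subset)
  then show False using uncountable_closed_interval[of a b] a_less_b by blast
qed

lemma attractor_level_antimono:
  "m \<le> n \<Longrightarrow> attractor_level {a..b} f N P n \<subseteq> attractor_level {a..b} f N P m"
proof (rule lift_Suc_antimono_le)
  show "attractor_level {a..b} f N P (Suc n) \<subseteq> attractor_level {a..b} f N P n" for n
  proof (induction n)
    case 0
    have "f ` ({a..b} - \<Delta>) \<subseteq> {a..b}" using maps_to by blast
    then show ?case by (simp add: closure_minimal)
  next
    case (Suc n)
    then have "f ` (attractor_level {a..b} f N P (Suc n) - \<Delta>) \<subseteq> f ` (attractor_level {a..b} f N P n - \<Delta>)"
      by (intro image_mono) blast
    then show ?case unfolding attractor_level.simps(2)[of _ _ _ _ "Suc n"]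
      unfolding attractor_level.simps(2)[of _ _ _ _ n, symmetric]
      by (metis attractor_level.simps(2) closure_mono)
  qed
qed

text \<open>
  The \<open>n\<close>-th point of a regular orbit lies in the \<open>n\<close>-th level, and the levels are closed and
  decreasing.
\<close>

lemma limit_in_attractor:
  assumes "x \<in> regular_points {a..b} f N P" "strict_mono s" "(\<lambda>k. (f ^^ s k) x) \<longlonglongrightarrow> y"
  shows "y \<in> attractor {a..b} f N P"
proof -
  have orbit: "(f ^^ n) x \<in> attractor_level {a..b} f N P n" for n
  proof (induction n)
    case 0
    then show ?case using assms(1) unfolding regular_points_def by auto
  next
    case (Suc n)
    have "(f ^^ n) x \<notin> \<Delta>"
      using assms(1) unfolding regular_points_def exceptional_set_def by auto
    then have "(f ^^ Suc n) x \<in> f ` (attractor_level {a..b} f N P n - \<Delta>)"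
      using Suc by simp
    then show ?case using closure_subset by fastforce
  qed
  have "y \<in> attractor_level {a..b} f N P n" for n
  proof (rule Lim_in_closed_set[OF _ _ _ assms(3)])
    show "closed (attractor_level {a..b} f N P n)" by (cases n) auto
    show "\<forall>\<^sub>F k in sequentially. (f ^^ s k) x \<in> attractor_level {a..b} f N P n"
      using eventually_ge_at_top[of n]
    proof eventually_elim
      case (elim k)
      then have "n \<le> s k" using seq_suble[OF assms(2), of k] by simp
      then show ?case using orbit attractor_level_antimono by blast
    qed
  qed simp
  then show ?thesis unfolding attractor_def by blast
qed

text \<open>
  Close to \<open>c\<close> and on one side of it there is a single piece, because \<open>\<Delta>\<close> is finite. On that piece \<open>f\<close>
  is Lipschitz, so its limit along one sequence is already its one-sided limit.
\<close>

lemma one_sided_limit: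
  assumes T: "T = {..<c} \<or> T = {c<..}"
    and z: "\<And>k. z k \<in> {a..b} \<inter> T" "z \<longlonglongrightarrow> c" "(\<lambda>k. f (z k)) \<longlonglongrightarrow> l"
  shows "c islimpt ({a..b} \<inter> T)" "(f \<longlongrightarrow> l) (at c within ({a..b} \<inter> T))"
proof -
  have "c \<notin> T" using T by auto
  then show "c islimpt ({a..b} \<inter> T)"
    using z unfolding islimpt_sequential by blast
  obtain e where e: "e > 0" "\<And>x. x \<in> \<Delta> \<Longrightarrow> x \<noteq> c \<Longrightarrow> e \<le> dist c x"
    using finite_set_avoid[OF finite_exceptional, of c] by blast
  let ?C = "{a..b} \<inter> T \<inter> ball c e"
  have "convex T" using T by auto
  then have "connected ?C"
    by (intro convex_connected convex_Int convex_ball) auto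
  moreover have "?C \<subseteq> pieces"
    using e(2) \<open>c \<notin> T\<close> unfolding exceptional_set_def by fastforce
  moreover have near: "\<forall>\<^sub>F k in sequentially. z k \<in> ?C"
    using topological_tendstoD[OF z(2), of "ball c e"] z(1) e(1) by auto
  then have "?C \<noteq> {}" using eventually_happens'[OF _ near] by force
  ultimately obtain i where i: "i \<in> {1..N}" "?C \<subseteq> P i"
    by (rule connected_subset_piece)
  have bound: "\<bar>f u - l\<bar> \<le> r * \<bar>u - c\<bar>" if u: "u \<in> ?C" for u
  proof (rule tendsto_le)
    show "(\<lambda>k. \<bar>f u - f (z k)\<bar>) \<longlonglongrightarrow> \<bar>f u - l\<bar>"
      by (intro tendsto_rabs tendsto_diff tendsto_const z(3))
    show "(\<lambda>k. r * \<bar>u - z k\<bar>) \<longlonglongrightarrow> r * \<bar>u - c\<bar>"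
      by (intro tendsto_mult tendsto_rabs tendsto_diff tendsto_const z(2))
    show "\<forall>\<^sub>F k in sequentially. \<bar>f u - f (z k)\<bar> \<le> r * \<bar>u - z k\<bar>"
      using near by eventually_elim (use contraction[OF i(1)] i(2) u in blast)
  qed simp
  have "\<forall>\<^sub>F u in at c within ({a..b} \<inter> T). u \<in> ball c e"
    using e(1) by (intro topological_tendstoD[OF tendsto_ident_at]) auto
  moreover have "\<forall>\<^sub>F u in at c within ({a..b} \<inter> T). u \<in> {a..b} \<inter> T"
    by (simp add: eventually_at_filter)
  ultimately have "\<forall>\<^sub>F u in at c within ({a..b} \<inter> T). norm (f u - l) \<le> r * norm (u - c)"
    by eventually_elim (use bound in simp)
  moreover have "((\<lambda>u. r * norm (u - c)) \<longlongrightarrow> 0) (at c within ({a..b} \<inter> T))"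
    by (auto intro!: tendsto_eq_intros)
  ultimately have "((\<lambda>u. f u - l) \<longlongrightarrow> 0) (at c within ({a..b} \<inter> T))"
    by (rule Lim_null_comparison)
  then show "(f \<longlongrightarrow> l) (at c within ({a..b} \<inter> T))" by (simp add: LIM_zero_iff)
qed

lemma convergent_subsequence:
  assumes "\<And>n. w n \<in> {a..b}"
  obtains y s where "y \<in> {a..b}" "strict_mono (s :: nat \<Rightarrow> nat)" "(\<lambda>k. w (s k)) \<longlonglongrightarrow> y"
proof -
  have "seq_compact {a..b}" by (rule compact_imp_seq_compact) (rule compact_Icc)
  moreover have "\<forall>n. w n \<in> {a..b}" using assms by blast
  ultimately obtain y s where "y \<in> {a..b}" "strict_mono (s :: nat \<Rightarrow> nat)" "(w \<circ> s) \<longlonglongrightarrow> y"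
    by (rule seq_compactE)
  then show ?thesis using that by (simp add: comp_def)
qed

text \<open>
  The orbit of a regular point \<open>x\<close> accumulates at some \<open>y\<close>. If \<open>y\<close> is not regular, its orbit follows
  the orbit of \<open>x\<close> by continuity up to the first time it hits \<open>\<Delta>\<close>, at \<open>c\<close> say; the orbit of \<open>x\<close> never
  equals \<open>c\<close>, so it approaches \<open>c\<close> infinitely often from one side, and its next points accumulate at a
  one-sided limit of \<open>f\<close>.
\<close>

lemma attractor_meets_regular_points:
  assumes D: "one_sided_limits {a..b} f N P \<subseteq> regular_points {a..b} f N P"
  shows "attractor {a..b} f N P \<inter> regular_points {a..b} f N P \<noteq> {}"
proof -
  obtain x where x: "x \<in> regular_points {a..b} f N P"
    using regular_points_nonempty by blast
  then have orbit: "(f ^^ n) x \<in> pieces" "(f ^^ n) x \<in> {a..b}" for n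
    using funpow_maps_to unfolding regular_points_def by auto
  obtain y s where y: "y \<in> {a..b}" and s: "strict_mono s" "(\<lambda>k. (f ^^ s k) x) \<longlonglongrightarrow> y"
    using convergent_subsequence[of "\<lambda>n. (f ^^ n) x"] orbit(2) by blast
  show ?thesis
  proof (cases "y \<in> regular_points {a..b} f N P")
    case True
    then show ?thesis using limit_in_attractor[OF x s] by blast
  next
    case False
    then have ex: "\<exists>k. (f ^^ k) y \<notin> pieces"
      using y unfolding regular_points_def by blast
    define k where "k = (LEAST k. (f ^^ k) y \<notin> pieces)"
    have k: "(f ^^ k) y \<notin> pieces" and before: "\<And>j. j < k \<Longrightarrow> (f ^^ j) y \<in> pieces"
      using LeastI_ex[OF ex] not_less_Least unfolding k_def by blast+
    define c where "c = (f ^^ k) y"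
    have c: "c \<in> \<Delta>"
      using k funpow_maps_to[OF y] unfolding c_def exceptional_set_def by blast
    define w where "w m = (f ^^ (s m + k)) x" for m
    have "(\<lambda>m. (f ^^ (s m + j)) x) \<longlonglongrightarrow> (f ^^ j) y" if "j \<le> k" for j
      using that
    proof (induction j)
      case (Suc j)
      have "(\<lambda>m. f ((f ^^ (s m + j)) x)) \<longlonglongrightarrow> f ((f ^^ j) y)"
      proof (rule continuous_within_tendsto_compose'[of _ "{a..b}" f])
        show "continuous (at ((f ^^ j) y) within {a..b}) f"
          using continuous_within_pieces[OF before] Suc.prems by (simp add: continuous_within)
      qed (use Suc orbit in auto)
      then show ?case by simp
    qed (use s in simp)
    then have w: "w \<longlonglongrightarrow> c" unfolding w_def c_def by blast
    have w_X: "w m \<in> {a..b}" "w m \<noteq> c" for m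
      using orbit k unfolding w_def c_def by metis+
    have "(UNIV :: nat set) = {m. w m \<in> {..<c}} \<union> {m. w m \<in> {c<..}}"
      using w_X(2) by (auto simp: neq_iff)
    then have "infinite {m. w m \<in> {..<c}} \<or> infinite {m. w m \<in> {c<..}}"
      using infinite_UNIV_nat by (metis finite_Un)
    then obtain T where T: "T = {..<c} \<or> T = {c<..}" "infinite {m. w m \<in> T}" by blast
    obtain t :: "nat \<Rightarrow> nat" where t: "strict_mono t" "\<And>m. w (t m) \<in> T"
      using infinite_enumerate[OF T(2)] by blast
    obtain l u where u: "strict_mono u" "(\<lambda>m. f (w (t (u m)))) \<longlonglongrightarrow> l"
      using convergent_subsequence[of "\<lambda>m. f (w (t m))"] maps_to[OF w_X(1)] by blast
    have tu: "strict_mono (\<lambda>m. t (u m))"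
      using t(1) u(1) by (simp add: strict_mono_def)
    have lim: "(\<lambda>m. w (t (u m))) \<longlonglongrightarrow> c"
      using LIMSEQ_subseq_LIMSEQ[OF w tu] by (simp add: comp_def)
    have in_T: "w (t (u m)) \<in> {a..b} \<inter> T" for m
      using t(2) w_X(1) by blast
    have "l \<in> one_sided_limits {a..b} f N P"
      unfolding one_sided_limits_def
      using one_sided_limit[OF T(1) in_T lim u(2)] T(1) c by blast
    moreover have "l \<in> attractor {a..b} f N P"
    proof (rule limit_in_attractor[OF x])
      show "strict_mono (\<lambda>m. Suc (s (t (u m)) + k))"
        using s(1) tu by (simp add: strict_mono_def)
      show "(\<lambda>m. (f ^^ Suc (s (t (u m)) + k)) x) \<longlonglongrightarrow> l"
        using u(2) unfolding w_def by simp
    qed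
    ultimately show ?thesis using D by blast
  qed
qed

lemma topological_entropy_attractor:
  assumes "one_sided_limits {a..b} f N P \<subseteq> regular_points {a..b} f N P"
  shows "topological_entropy f (attractor {a..b} f N P \<inter> regular_points {a..b} f N P) = 0"
proof (rule topological_entropy_zero)
  fix \<epsilon> :: real assume "\<epsilon> > 0"
  then obtain C where "\<And>n. spanning_number f (attractor {a..b} f N P \<inter> regular_points {a..b} f N P) n \<epsilon>
      \<le> enat (C * Suc n)"
    using spanning_number_linear[of "attractor {a..b} f N P \<inter> regular_points {a..b} f N P"] by blast
  then show "entropy_at_scale f (attractor {a..b} f N P \<inter> regular_points {a..b} f N P) \<epsilon> = 0"
    by (rule entropy_at_scale_zero[OF attractor_meets_regular_points[OF assms]])
qed

end

text \<open>
  Points of different pieces have different images by the disjointness of the closures, and points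
  of the same piece by strict monotonicity.
\<close>

lemma separation_property_imp_inj:
  assumes "separation_property f N P"
  shows "inj_on f (pieces_union N P)"
proof (rule inj_onI)
  fix x y assume xy: "x \<in> pieces_union N P" "y \<in> pieces_union N P" "f x = f y"
  then obtain i j where ij: "i \<in> {1..N}" "x \<in> P i" "j \<in> {1..N}" "y \<in> P j"
    unfolding pieces_union_def by blast
  have "f x \<in> closure (f ` P i)" "f x \<in> closure (f ` P j)"
    using ij xy(3) closure_subset by (metis image_eqI subsetD)+
  then have "i = j"
    using assms ij unfolding separation_property_def by blast
  have "strict_mono_on (P i) f \<or> strict_antimono_on (P i) f"
    using assms ij(1) unfolding separation_property_def piecewise_monotonic_def by blast
  then have "u < v \<Longrightarrow> f u \<noteq> f v" if "u \<in> P i" "v \<in> P i" for u v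
    using that unfolding monotone_on_def by force
  then show "x = y"
    using ij xy(3) \<open>i = j\<close> by (metis linorder_neqE)
qed

theorem theorem1p3:
  fixes X :: "real set" and f :: "real \<Rightarrow> real" and N :: nat and P :: "nat \<Rightarrow> real set"
  assumes "pcim X f N P"
    and "separation_property f N P"
    and "one_sided_limits X f N P \<subseteq> regular_points X f N P"
  shows "hausdorff_dimension (attractor X f N P) = 0 \<and>
    topological_entropy f (attractor X f N P \<inter> regular_points X f N P) = 0"
proof -
  have "\<exists>a b. a < b \<and> X = {a..b}"
    using assms(1) unfolding pcim_def by (elim conjE)
  then obtain a b where ab: "a < b" "X = {a..b}" by blast
  have "\<exists>r. 0 < r \<and> r < 1 \<and> (\<forall>i\<in>{1..N}. \<forall>x\<in>P i. \<forall>y\<in>P i. \<bar>f x - f y\<bar> \<le> r * \<bar>x - y\<bar>)"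
    using assms(1) unfolding pcim_def by (elim conjE)
  then obtain r where r: "0 < r" "r < 1"
    "\<forall>i\<in>{1..N}. \<forall>x\<in>P i. \<forall>y\<in>P i. \<bar>f x - f y\<bar> \<le> r * \<bar>x - y\<bar>" by blast
  have maps: "f ` X \<subseteq> X"
    using assms(1) unfolding pcim_def by (elim conjE)
  have pieces: "\<forall>i\<in>{1..N}. P i \<noteq> {} \<and> is_interval (P i) \<and> openin (top_of_set X) (P i)"
    using assms(1) unfolding pcim_def by (elim conjE)
  have disj: "disjoint_family_on P {1..N}"
    using assms(1) unfolding pcim_def by (elim conjE)
  have cover: "X = (\<Union>i\<in>{1..N}. closure (P i))"
    using assms(1) unfolding pcim_def by (elim conjE)
  interpret injective_pcim a b r f N P
  proof
    show "f x \<in> {a..b}" if "x \<in> {a..b}" for x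
      using maps that unfolding ab(2) by (rule subsetD[OF _ imageI])
    show "is_interval (P i)" "openin (top_of_set {a..b}) (P i)" if "i \<in> {1..N}" for i
      using bspec[OF pieces that] unfolding ab(2) by simp_all
    show "{a..b} = (\<Union>i\<in>{1..N}. closure (P i))" using cover unfolding ab(2) .
    show "inj_on f (pieces_union N P)" using assms(2) by (rule separation_property_imp_inj)
    show "\<bar>f x - f y\<bar> \<le> r * \<bar>x - y\<bar>" if "i \<in> {1..N}" "x \<in> P i" "y \<in> P i" for i x y
      using r(3) that by blast
  qed (fact ab r disj)+
  show ?thesis
    using hausdorff_dimension_attractor topological_entropy_attractor[OF assms(3)[unfolded ab(2)]]
    unfolding ab(2) by (rule conjI)
qed

end
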